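(* If $f\in F_0$, then $f\in BMOA$.
   Context: $D$ is the open unit disk in the complex plane and $T$ is the unit circle. $M$ is the Banach space of all complex-valued (finite) Borel measures on $T$ with the total variation norm. $F_0$ is the family of functions $f$ analytic in $D$ for which there exists $\mu\in M$ with $f(z)=f(0)+\int_T\log\left(\frac{1}{1-\overline{\xi}z}\right)d\mu(\xi)$ for all $z\in D$ (principal branch of the logarithm). $BMOA$ is the usual space of analytic functions of bounded mean oscillation on $D$, i.e. functions in the Hardy space $H^1$ whose boundary values on $T$ have bounded mean oscillation; equivalently, it is the dual of $H^1$ under the pairing $\langle f,h\rangle=\lim_{r\to1^-}\int_T\overline{f(r\xi)}\,h(\xi)\,dm(\xi)$, where $m$ is normalized Lebesgue measure on $T$. *)

theory Defs
  imports "HOL-Analysis.Analysis"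
begin

abbreviation unit_disk :: "complex set" where
  "unit_disk \<equiv> ball 0 1"

abbreviation unit_circle :: "complex set" where
  "unit_circle \<equiv> sphere 0 1"

text \<open>The Borel \<open>\<sigma>\<close>-algebra of the circle; only its space and its sets are relevant.\<close>

definition circle_borel :: "complex measure" where
  "circle_borel = restrict_space borel unit_circle"

text \<open>
  A complex measure is a countably additive complex-valued set function on the measurable sets
  of \<open>S\<close>, with arbitrary values elsewhere; that the empty set has measure zero follows, as the
  constant series \<open>\<mu> {} + \<mu> {} + \<dots>\<close> converges.
\<close>

definition complex_measure :: "'a measure \<Rightarrow> ('a set \<Rightarrow> complex) \<Rightarrow> bool" where
  "complex_measure S \<mu> \<longleftrightarrow>
     (\<forall>A :: nat \<Rightarrow> 'a set. range A \<subseteq> sets S \<longrightarrow> disjoint_family A \<longrightarrow>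
        (\<lambda>n. \<mu> (A n)) sums \<mu> (\<Union>n. A n))"

text \<open>
  The positive part of the Jordan decomposition of a finite signed measure \<open>\<nu>\<close>; the negative part
  is the positive part of \<open>-\<nu>\<close>. The set \<open>B = {}\<close> makes the supremum unaffected by
  \<^const>\<open>ennreal\<close> truncating negative numbers to zero.
\<close>

definition positive_variation :: "'a measure \<Rightarrow> ('a set \<Rightarrow> real) \<Rightarrow> 'a measure" where
  "positive_variation S \<nu> =
     measure_of (space S) (sets S) (\<lambda>A. SUP B\<in>{B \<in> sets S. B \<subseteq> A}. ennreal (\<nu> B))"

definition complex_measure_integral ::
    "'a measure \<Rightarrow> ('a set \<Rightarrow> complex) \<Rightarrow> ('a \<Rightarrow> complex) \<Rightarrow> complex" where
  "complex_measure_integral S \<mu> f =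
     (LINT x|positive_variation S (\<lambda>A. Re (\<mu> A)). f x)
     - (LINT x|positive_variation S (\<lambda>A. - Re (\<mu> A)). f x)
     + \<i> * ((LINT x|positive_variation S (\<lambda>A. Im (\<mu> A)). f x)
            - (LINT x|positive_variation S (\<lambda>A. - Im (\<mu> A)). f x))"

definition F_0 :: "(complex \<Rightarrow> complex) set" where
  "F_0 = {f. f holomorphic_on unit_disk \<and>
     (\<exists>\<mu>. complex_measure circle_borel \<mu> \<and>
        (\<forall>z\<in>unit_disk.
           f z = f 0 + complex_measure_integral circle_borel \<mu> (\<lambda>\<xi>. Ln (1 / (1 - cnj \<xi> * z)))))}"

definition circle_lebesgue :: "complex measure" where
  "circle_lebesgue = distr (uniform_measure lborel {0..2 * pi}) circle_borel cis"

definition Hardy_1 :: "(complex \<Rightarrow> complex) set" where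
  "Hardy_1 = {f. f holomorphic_on unit_disk \<and>
     (\<exists>C. \<forall>r\<in>{0..<1}. (LINT \<xi>|circle_lebesgue. norm (f (complex_of_real r * \<xi>))) \<le> C)}"

definition circle_mean :: "(complex \<Rightarrow> complex) \<Rightarrow> complex set \<Rightarrow> complex" where
  "circle_mean \<phi> I = (LINT \<xi>:I|circle_lebesgue. \<phi> \<xi>) / complex_of_real (measure circle_lebesgue I)"

definition mean_oscillation :: "(complex \<Rightarrow> complex) \<Rightarrow> complex set \<Rightarrow> real" where
  "mean_oscillation \<phi> I =
     (LINT \<xi>:I|circle_lebesgue. norm (\<phi> \<xi> - circle_mean \<phi> I)) / measure circle_lebesgue I"

definition circle_arcs :: "complex set set" where
  "circle_arcs = {cis ` {a..b} | a b. a < b \<and> b \<le> a + 2 * pi}"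

definition BMO_circle :: "(complex \<Rightarrow> complex) set" where
  "BMO_circle = {\<phi>. integrable circle_lebesgue \<phi> \<and>
     (\<exists>C. \<forall>I\<in>circle_arcs. mean_oscillation \<phi> I \<le> C)}"

text \<open>
  Boundary values are radial limits almost everywhere, hence unique up to null sets.
  They exist for every function in \<^const>\<open>Hardy_1\<close> by Fatou's theorem.
\<close>

definition has_boundary_values :: "(complex \<Rightarrow> complex) \<Rightarrow> (complex \<Rightarrow> complex) \<Rightarrow> bool" where
  "has_boundary_values f \<phi> \<longleftrightarrow>
     (AE \<xi> in circle_lebesgue. ((\<lambda>r. f (complex_of_real r * \<xi>)) \<longlongrightarrow> \<phi> \<xi>) (at_left 1))"

definition BMOA :: "(complex \<Rightarrow> complex) set" where
  "BMOA = {f \<in> Hardy_1. \<exists>\<phi>\<in>BMO_circle. has_boundary_values f \<phi>}"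

end

theory Submission
  imports Defs
begin

text \<open>
  A finite complex measure is a linear combination of four finite positive measures \<open>N\<close>, so up to
  a constant \<open>f\<close> is a linear combination of logarithmic potentials
  \<open>z \<mapsto> \<integral> Ln (1 / (1 - cnj \<xi> * z)) \<partial>N(\<xi>)\<close>. Each of these inherits what is true of the kernel
  uniformly in \<open>\<xi>\<close>, by Tonelli's theorem and dominated convergence. The argument is real-variable;
  neither Fatou's theorem nor the duality with \<open>H\<^sup>1\<close> is used.

  The imaginary part of the kernel is bounded, and its real part is \<open>- ln (norm (1 - cnj \<xi> * z))\<close>.
  Everything about the latter follows from one estimate, \<open>nn_integral_log_spike_le\<close>: with
  \<open>V_h = max 0 (ln (h / norm (1 - cnj \<xi> * \<eta>)))\<close>, the integral of \<open>V_h\<close> over the whole circle is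
  \<open>O(h)\<close>, uniformly in \<open>\<xi>\<close>.

  For \<open>h = 2\<close> the kernel at \<open>r\<eta>\<close>, \<open>0 \<le> r \<le> 1\<close>, is dominated by \<open>5 + V_2\<close>
  (\<open>norm_log_kernel_radial_le\<close>). This bounds the \<open>L\<^sup>1\<close> means of a potential over the circles of
  radius \<open>r\<close>, and it gives its radial limits: at almost every \<open>\<eta>\<close> the potential is defined on the
  circle as an absolutely convergent integral, which is the radial limit by dominated convergence.

  For the mean oscillation over an arc \<open>I\<close> of length \<open>h\<close> starting at \<open>\<eta>\<^sub>0\<close>, compare the kernel with the
  constant \<open>c(\<xi>) = - ln (max h (norm (1 - cnj \<xi> * \<eta>\<^sub>0)))\<close>. On \<open>I\<close> the difference is at most
  \<open>5 + V_{2h}\<close> (\<open>norm_log_kernel_oscillation_le\<close>), so its integral over \<open>I\<close> is \<open>O(h)\<close>, hence at most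
  a constant times the measure of \<open>I\<close>. Integrating over \<open>\<xi>\<close> bounds the oscillation of the potential.
\<close>

section \<open>Normalized Lebesgue measure on the circle\<close>

lemma space_circle_borel [simp]: "space circle_borel = unit_circle"
  by (simp add: circle_borel_def space_restrict_space)

lemma sets_circle_lebesgue [simp, measurable_cong]: "sets circle_lebesgue = sets circle_borel"
  by (simp add: circle_lebesgue_def)

lemma space_circle_lebesgue [simp]: "space circle_lebesgue = unit_circle"
  using sets_eq_imp_space_eq[OF sets_circle_lebesgue] by simp

lemma closed_subset_circle_borel:
  assumes "closed A" "A \<subseteq> unit_circle"
  shows "A \<in> sets circle_borel"
  using assms by (auto simp: circle_borel_def sets_restrict_space intro!: image_eqI[of _ _ A])

lemma borel_measurable_circle_borel:
  "f \<in> borel_measurable borel \<Longrightarrow> f \<in> borel_measurable circle_borel"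
  by (simp add: circle_borel_def measurable_restrict_space1)

lemma measurable_cis_circle_borel [measurable]: "cis \<in> borel \<rightarrow>\<^sub>M circle_borel"
  unfolding circle_borel_def
  by (intro measurable_restrict_space2 borel_measurable_continuous_onI continuous_intros) auto

lemma measurable_cis_uniform [measurable]:
  "cis \<in> uniform_measure lborel {0..2 * pi} \<rightarrow>\<^sub>M circle_borel"
  by (subst measurable_cong_sets[OF _ refl, where M' = borel]) auto

lemma nn_integral_circle_lebesgue:
  assumes [measurable]: "f \<in> borel_measurable circle_borel"
  shows "(\<integral>\<^sup>+\<eta>. f \<eta> \<partial>circle_lebesgue)
         = (\<integral>\<^sup>+\<theta>. f (cis \<theta>) * indicator {0..2*pi} \<theta> \<partial>lborel) / ennreal (2 * pi)"
  unfolding circle_lebesgue_def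
  by (subst nn_integral_distr) (auto simp: nn_integral_uniform_measure)

lemma emeasure_circle_lebesgue:
  assumes [measurable]: "A \<in> sets circle_borel"
  shows "emeasure circle_lebesgue A = emeasure lborel ({0..2*pi} \<inter> cis -` A) / ennreal (2 * pi)"
proof -
  have "cis -` A \<in> sets borel"
    using measurable_sets[OF measurable_cis_circle_borel assms] by simp
  then show ?thesis
    unfolding circle_lebesgue_def by (subst emeasure_distr) auto
qed

lemma finite_measure_circle_lebesgue: "finite_measure circle_lebesgue"
proof
  have "emeasure circle_lebesgue unit_circle \<le> emeasure lborel {0..2*pi} / ennreal (2 * pi)"
    by (subst emeasure_circle_lebesgue)
      (intro closed_subset_circle_borel divide_right_mono_ennreal emeasure_mono; simp)+
  also have "\<dots> < \<infinity>"
    by (simp add: divide_ennreal)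
  finally show "emeasure circle_lebesgue (space circle_lebesgue) \<noteq> \<infinity>"
    by simp
qed

interpretation circle: finite_measure circle_lebesgue
  by (rule finite_measure_circle_lebesgue)

lemma arc_measurable:
  assumes "I \<in> circle_arcs" shows "I \<in> sets circle_borel"
proof -
  obtain a b where "I = cis ` {a..b}"
    using assms by (auto simp: circle_arcs_def)
  then show ?thesis
    by (auto intro!: closed_subset_circle_borel compact_imp_closed compact_continuous_image continuous_intros)
qed

text \<open>The exact value is \<open>(b - a) / (2 * pi)\<close>; losing a factor of two lets a single interval of parameters suffice
  when the arc wraps around the point \<open>1\<close>.\<close>

lemma measure_arc_ge:
  assumes "a < b" "b \<le> a + 2 * pi"
  shows "b - a \<le> 4 * pi * measure circle_lebesgue (cis ` {a..b})"
proof -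
  \<comment> \<open>Translate the parameters so that the arc starts in \<open>[0, 2 * pi)\<close>. One of the two pieces of the
    translated interval on either side of \<open>2 * pi\<close> has at least half of the length.\<close>
  define n where "n = \<lfloor>a / (2 * pi)\<rfloor>"
  define a' b' where "a' = a - 2 * pi * n" and "b' = b - 2 * pi * n"
  have "of_int n \<le> a / (2 * pi)" "a / (2 * pi) < of_int n + 1"
    unfolding n_def by linarith+
  then have a': "0 \<le> a'" "a' < 2 * pi"
    by (auto simp: a'_def field_simps)
  have eq: "cis (x + 2 * pi * of_int n) = cis x" for x
    by (simp add: cis_mult[symmetric] cis_multiple_2pi)
  have sub: "cis -` (cis ` {a..b}) \<supseteq> {a'..b'}"
  proof
    fix x assume "x \<in> {a'..b'}"
    then have "x + 2 * pi * of_int n \<in> {a..b}" by (auto simp: a'_def b'_def)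
    then show "x \<in> cis -` (cis ` {a..b})"
      using eq[of x] by (metis image_eqI vimageI)
  qed
  have per: "cis (x - 2 * pi) = cis x" for x
    by (simp add: cis_divide[symmetric])
  have sub': "cis -` (cis ` {a..b}) \<supseteq> {a' - 2 * pi..b' - 2 * pi}"
  proof
    fix x assume "x \<in> {a' - 2 * pi..b' - 2 * pi}"
    then have "x + 2 * pi \<in> {a'..b'}" by auto
    then have "cis (x + 2 * pi) \<in> cis ` {a..b}" using sub by blast
    then show "x \<in> cis -` (cis ` {a..b})"
      using per[of "x + 2 * pi"] by simp
  qed
  have S [measurable]: "cis -` (cis ` {a..b}) \<in> sets borel"
  proof -
    have "cis ` {a..b} \<in> sets circle_borel"
      using assms by (intro arc_measurable) (auto simp: circle_arcs_def)
    then show ?thesis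
      using measurable_sets[OF measurable_cis_circle_borel] by fastforce
  qed
  have len: "b' - a' = b - a" by (simp add: a'_def b'_def)
  obtain u v where uv: "u \<le> v" "{u..v} \<subseteq> {0..2 * pi}" "{u..v} \<subseteq> cis -` (cis ` {a..b})"
    "v - u \<ge> (b - a) / 2"
  proof (cases "min b' (2 * pi) - a' \<ge> (b - a) / 2")
    case True
    moreover have "{a'..min b' (2 * pi)} \<subseteq> {a'..b'}" "{a'..min b' (2 * pi)} \<subseteq> {0..2 * pi}"
      using a' by auto
    moreover have "a' \<le> min b' (2 * pi)"
      using True assms order_trans[of 0 "(b - a) / 2" "min b' (2 * pi) - a'"] by auto
    ultimately show ?thesis
      using that[of a' "min b' (2 * pi)"] sub by blast
  next
    case False
    then have large: "b' - 2 * pi \<ge> (b - a) / 2" and b': "b' \<le> a' + 2 * pi"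
      using assms len by (auto simp: min_def split: if_splits)
    have "{0..b' - 2 * pi} \<subseteq> {a' - 2 * pi..b' - 2 * pi}" "{0..b' - 2 * pi} \<subseteq> {0..2 * pi}"
      using a' b' by auto
    moreover have "0 \<le> b' - 2 * pi"
      using large assms order_trans[of 0 "(b - a) / 2" "b' - 2 * pi"] by auto
    ultimately show ?thesis
      using that[of 0 "b' - 2 * pi"] sub' large by (metis diff_zero order_trans)
  qed
  have "emeasure lborel {u..v} / ennreal (2 * pi)
      \<le> emeasure lborel ({0..2*pi} \<inter> cis -` (cis ` {a..b})) / ennreal (2 * pi)"
    using uv by (intro divide_right_mono_ennreal emeasure_mono) auto
  also have "\<dots> = emeasure circle_lebesgue (cis ` {a..b})"
    using assms by (intro emeasure_circle_lebesgue[symmetric] arc_measurable)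
      (auto simp: circle_arcs_def)
  finally have "ennreal ((v - u) / (2 * pi)) \<le> ennreal (measure circle_lebesgue (cis ` {a..b}))"
    using uv by (simp add: divide_ennreal circle.emeasure_eq_measure)
  then have "(v - u) / (2 * pi) \<le> measure circle_lebesgue (cis ` {a..b})"
    by simp
  then have "v - u \<le> 2 * pi * measure circle_lebesgue (cis ` {a..b})"
    by (simp add: field_simps)
  moreover have "b - a \<le> 2 * (v - u)" using uv(4) by (simp add: field_simps)
  ultimately show ?thesis by simp
qed

lemma measure_arc_pos:
  assumes "I \<in> circle_arcs" shows "0 < measure circle_lebesgue I"
proof -
  obtain a b where ab: "a < b" "b \<le> a + 2 * pi" "I = cis ` {a..b}"
    using assms by (auto simp: circle_arcs_def)
  then have "0 < 4 * pi * measure circle_lebesgue I"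
    using measure_arc_ge[of a b] by simp
  then show ?thesis
    by (simp add: zero_less_mult_iff)
qed

section \<open>The logarithmic singularity is integrable\<close>

lemma half_le_sin:
  assumes "0 \<le> x" "x \<le> pi / 2" shows "x / 2 \<le> sin x"
proof (cases "x \<le> pi / 3")
  case True
  show ?thesis
  proof (cases "x = 0")
    case False
    then obtain c where "0 < c" "c < x" "sin x - sin 0 = (x - 0) * cos c"
      using MVT2[of 0 x sin cos] assms by (auto intro: DERIV_sin)
    moreover have "cos (pi / 3) \<le> cos c"
      using True \<open>0 < c\<close> \<open>c < x\<close> by (intro cos_monotone_0_pi_le) auto
    ultimately have "sin x = x * cos c" "1 / 2 \<le> cos c" by (auto simp: cos_60)
    then show ?thesis using assms by (simp add: mult_left_mono[of "1/2" "cos c" x, simplified])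
  qed auto
next
  case False
  have "x / 2 \<le> 4 / 5"
    using assms pi_approx by simp
  also have "4 / 5 \<le> sqrt 3 / 2"
    using real_le_rsqrt[of "8 / 5" 3] by (simp add: power2_eq_square)
  also have "\<dots> = sin (pi / 3)" by (simp add: sin_60)
  also have "\<dots> \<le> sin x"
    using False assms by (intro sin_monotone_2pi_le) auto
  finally show ?thesis .
qed

lemma norm_one_minus_cis_ge:
  assumes "\<bar>t\<bar> \<le> pi" shows "\<bar>t\<bar> / 2 \<le> norm (1 - cis t)"
proof -
  have "norm (1 - cis t) = 2 * \<bar>sin (t / 2)\<bar>"
    using dist_exp_i_1[of t] by (simp add: cis_conv_exp norm_minus_commute)
  moreover have "\<bar>t\<bar> / 2 / 2 \<le> sin (\<bar>t\<bar> / 2)"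
    using assms by (intro half_le_sin) auto
  moreover have "sin (\<bar>t\<bar> / 2) \<le> \<bar>sin (t / 2)\<bar>"
    by (cases "t \<ge> 0") (auto simp: abs_if)
  ultimately show ?thesis by linarith
qed

text \<open>
  The positive part of \<open>ln (h / norm w)\<close>, which is supported in the disk of radius \<open>h\<close>. Because
  \<^term>\<open>ln 0 = (0::real)\<close> and division by zero yields zero, its value at the singularity \<open>w = 0\<close> is \<open>0\<close>;
  bounds by it are therefore stated away from that point.
\<close>

definition log_spike :: "real \<Rightarrow> complex \<Rightarrow> real" where
  "log_spike h w = max 0 (ln (h / norm w))"

lemma log_spike_nonneg [simp]: "0 \<le> log_spike h w"
  by (simp add: log_spike_def)

lemma measurable_log_spike [measurable]: "log_spike h \<in> borel_measurable borel"
  unfolding log_spike_def by measurable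

lemma log_spike_cis_le:
  assumes "\<bar>t\<bar> \<le> pi" "h > 0"
  shows "log_spike h (1 - cis t) \<le> 2 * sqrt (2 * h) * \<bar>t\<bar> powr (-1/2) * indicator {0..2*h} \<bar>t\<bar>"
proof (cases "norm (1 - cis t) \<ge> h \<or> 1 - cis t = 0")
  case True
  then have "log_spike h (1 - cis t) = 0"
    using assms ln_le_zero_iff[of "h / norm (1 - cis t)"]
    by (cases "1 - cis t = 0") (auto simp: log_spike_def max_def)
  then show ?thesis using assms by simp
next
  case False
  then have d: "0 < norm (1 - cis t)" "norm (1 - cis t) < h" by auto
  have t: "0 < \<bar>t\<bar>" using False by auto
  have le: "\<bar>t\<bar> / 2 \<le> norm (1 - cis t)" by (rule norm_one_minus_cis_ge) fact
  have "h / norm (1 - cis t) \<le> h / (\<bar>t\<bar> / 2)"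
    using t le d assms by (intro divide_left_mono) auto
  then have le2: "h / norm (1 - cis t) \<le> 2 * h / \<bar>t\<bar>" by (simp add: mult.commute)
  have "ln (h / norm (1 - cis t)) \<le> ln (2 * h / \<bar>t\<bar>)"
    using le2 d assms by (intro ln_mono) auto
  also have "\<dots> = 2 * ln (sqrt (2 * h / \<bar>t\<bar>))"
    using t assms by (simp add: ln_sqrt)
  also have "\<dots> \<le> 2 * sqrt (2 * h / \<bar>t\<bar>)"
    using t assms by (simp add: ln_bound)
  also have "\<dots> = 2 * sqrt (2 * h) * \<bar>t\<bar> powr (-1/2)"
    using t by (simp add: real_sqrt_divide powr_minus_divide powr_half_sqrt)
  finally have "log_spike h (1 - cis t) \<le> 2 * sqrt (2 * h) * \<bar>t\<bar> powr (-1/2)"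
    using assms by (simp add: log_spike_def)
  moreover have "\<bar>t\<bar> \<in> {0..2*h}" using le d by auto
  ultimately show ?thesis by simp
qed

text \<open>Since \<open>ln x \<le> 2 * sqrt x\<close>, an inverse square root dominates the logarithm and is easy to integrate.\<close>

lemma nn_integral_inverse_sqrt:
  assumes "h > 0"
  shows "(\<integral>\<^sup>+t. ennreal (2 * sqrt (2 * h) * \<bar>t - c\<bar> powr (-1/2) * indicator {0..2*h} \<bar>t - c\<bar>) \<partial>lborel)
         \<le> ennreal (16 * h)" (is "(\<integral>\<^sup>+t. ?q (t - c) \<partial>lborel) \<le> _")
proof -
  let ?p = "\<lambda>t. ennreal (2 * sqrt (2 * h) * t powr (-1/2) * indicator {0..2*h} t)"
  have "((\<lambda>t. t powr (-1/2)) has_integral ((2 * h) powr (-1/2 + 1) / (-1/2 + 1))) {0..2*h}"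
    using assms by (intro has_integral_powr_from_0) auto
  then have "((\<lambda>t. 2 * sqrt (2 * h) * t powr (-1/2)) has_integral
      (2 * sqrt (2 * h) * ((2 * h) powr (-1/2 + 1) / (-1/2 + 1)))) {0..2*h}"
    by (rule has_integral_mult_right)
  also have "2 * sqrt (2 * h) * ((2 * h) powr (-1/2 + 1) / (-1/2 + 1)) = 8 * h"
    using assms by (simp add: powr_half_sqrt)
  finally have I: "((\<lambda>t. 2 * sqrt (2 * h) * t powr (-1/2)) has_integral 8 * h) {0..2*h}" .
  have p: "(\<integral>\<^sup>+t. ?p t \<partial>lborel) = ennreal (8 * h)"
    using nn_integral_has_integral_lebesgue[OF _ I] assms by (simp add: mult.commute)
  have "(\<integral>\<^sup>+t. ?q (t - c) \<partial>lborel) = (\<integral>\<^sup>+t. ?q t \<partial>lborel)"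
    using nn_integral_real_affine[of ?q 1 "-c"] by simp
  also have "\<dots> \<le> (\<integral>\<^sup>+t. ?p t + ?p (- t) \<partial>lborel)"
    using assms by (intro nn_integral_mono) (auto simp: abs_if split: split_indicator)
  also have "\<dots> = (\<integral>\<^sup>+t. ?p t \<partial>lborel) + (\<integral>\<^sup>+t. ?p (- t) \<partial>lborel)"
    by (intro nn_integral_add) auto
  also have "(\<integral>\<^sup>+t. ?p (- t) \<partial>lborel) = (\<integral>\<^sup>+t. ?p t \<partial>lborel)"
    using nn_integral_real_affine[of ?p "-1" 0] by simp
  finally show ?thesis
    unfolding p using assms by (simp flip: ennreal_plus)
qed

text \<open>The spike of width \<open>h\<close> has integral of order \<open>h\<close> over the circle, uniformly in its position \<open>\<xi>\<close>.\<close>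

lemma nn_integral_log_spike_le:
  assumes "h > 0" "norm \<xi> = 1"
  shows "(\<integral>\<^sup>+\<eta>. ennreal (log_spike h (1 - cnj \<xi> * \<eta>)) \<partial>circle_lebesgue) \<le> ennreal (32 * h)"
proof -
  define \<alpha> where "\<alpha> = Arg \<xi>"
  have \<xi>: "\<xi> = cis \<alpha>"
    using assms cis_Arg[of \<xi>] by (cases "\<xi> = 0") (auto simp: \<alpha>_def sgn_div_norm)
  have \<alpha>: "- pi < \<alpha>" "\<alpha> \<le> pi" using Arg_bounded[of \<xi>] by (auto simp: \<alpha>_def)
  let ?q = "\<lambda>t. 2 * sqrt (2 * h) * \<bar>t\<bar> powr (-1/2) * indicator {0..2*h} \<bar>t\<bar>"
  have q0: "0 \<le> ?q t" for t using assms by simp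
  have pt: "log_spike h (1 - cnj \<xi> * cis \<theta>) \<le> ?q (\<theta> - \<alpha>) + ?q (\<theta> - (\<alpha> + 2 * pi))"
    if "0 \<le> \<theta>" "\<theta> \<le> 2 * pi" for \<theta>
  proof -
    have e: "cnj \<xi> * cis \<theta> = cis (\<theta> - \<alpha>)"
      by (simp add: \<xi> cis_cnj cis_mult)
    have e': "cis (\<theta> - \<alpha>) = cis (\<theta> - (\<alpha> + 2 * pi))"
      using cis_divide[of "\<theta> - \<alpha>" "2 * pi"] by (simp add: diff_diff_eq)
    \<comment> \<open>The angle \<open>\<theta> - \<alpha>\<close> lies in \<open>[- pi, 3 * pi)\<close>, within \<open>pi\<close> of \<open>0\<close> or of \<open>2 * pi\<close>.\<close>
    show ?thesis
    proof (cases "\<theta> - \<alpha> \<le> pi")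
      case True
      then have "\<bar>\<theta> - \<alpha>\<bar> \<le> pi" using that \<alpha> by auto
      from log_spike_cis_le[OF this \<open>h > 0\<close>] q0[of "\<theta> - (\<alpha> + 2 * pi)"] show ?thesis
        unfolding e by linarith
    next
      case False
      then have "\<bar>\<theta> - (\<alpha> + 2 * pi)\<bar> \<le> pi" using that \<alpha> by auto
      from log_spike_cis_le[OF this \<open>h > 0\<close>] q0[of "\<theta> - \<alpha>"] show ?thesis
        unfolding e e' by linarith
    qed
  qed
  have "(\<integral>\<^sup>+\<theta>. ennreal (log_spike h (1 - cnj \<xi> * cis \<theta>)) * indicator {0..2*pi} \<theta> \<partial>lborel)
      \<le> (\<integral>\<^sup>+\<theta>. ennreal (?q (\<theta> - \<alpha>)) + ennreal (?q (\<theta> - (\<alpha> + 2 * pi))) \<partial>lborel)"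
    using pt q0 by (auto intro!: nn_integral_mono simp flip: ennreal_plus simp: ennreal_leI split: split_indicator)
  also have "\<dots> = (\<integral>\<^sup>+\<theta>. ennreal (?q (\<theta> - \<alpha>)) \<partial>lborel) + (\<integral>\<^sup>+\<theta>. ennreal (?q (\<theta> - (\<alpha> + 2 * pi))) \<partial>lborel)"
    by (intro nn_integral_add) auto
  also have "\<dots> \<le> ennreal (16 * h) + ennreal (16 * h)"
    using assms by (intro add_mono nn_integral_inverse_sqrt) auto
  also have "\<dots> = ennreal (32 * h)"
    using assms by (simp flip: ennreal_plus)
  finally have le: "(\<integral>\<^sup>+\<theta>. ennreal (log_spike h (1 - cnj \<xi> * cis \<theta>)) * indicator {0..2*pi} \<theta> \<partial>lborel)
      \<le> ennreal (32 * h)" .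
  have "(\<integral>\<^sup>+\<eta>. ennreal (log_spike h (1 - cnj \<xi> * \<eta>)) \<partial>circle_lebesgue)
      = (\<integral>\<^sup>+\<theta>. ennreal (log_spike h (1 - cnj \<xi> * cis \<theta>)) * indicator {0..2*pi} \<theta> \<partial>lborel) / ennreal (2 * pi)"
    by (intro nn_integral_circle_lebesgue borel_measurable_circle_borel) measurable
  also have "\<dots> \<le> ennreal (32 * h) / ennreal (2 * pi)"
    by (rule divide_right_mono_ennreal[OF le])
  also have "\<dots> = ennreal (32 * h / (2 * pi))"
    using assms by (intro divide_ennreal) auto
  also have "\<dots> \<le> ennreal (32 * h)"
    using assms pi_gt3 by (intro ennreal_leI) (auto simp: field_simps)
  finally show ?thesis .
qed

lemma singleton_null_circle: "{\<xi>} \<in> null_sets circle_lebesgue" if "norm \<xi> = 1"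
proof -
  have *: "{0..2*pi} \<inter> cis -` {\<xi>} \<subseteq> insert (2*pi) {Arg2pi \<xi>}"
    using Arg2pi_unique[of 1 _ \<xi>] by (force simp: cis_conv_exp)
  have "finite ({0..2*pi} \<inter> cis -` {\<xi>})"
    by (rule finite_subset[OF *]) simp
  then have "emeasure lborel ({0..2*pi} \<inter> cis -` {\<xi>}) = 0"
    by (intro emeasure_lborel_countable countable_finite)
  moreover have "{\<xi>} \<in> sets circle_borel" using that by (intro closed_subset_circle_borel) auto
  ultimately show ?thesis
    by (simp add: null_sets_def emeasure_circle_lebesgue)
qed

section \<open>Pointwise bounds for the kernel\<close>

lemma measurable_Ln [measurable]: "Ln \<in> borel_measurable borel"
proof -
  have 1: "Ln \<in> borel_measurable (restrict_space borel {z. z \<notin> \<real>\<^sub>\<le>\<^sub>0})"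
    by (intro borel_measurable_continuous_on_restrict continuous_intros) auto
  have 2: "(\<lambda>z. if z = 0 then Ln 0 else Complex (ln (norm z)) pi)
      \<in> borel_measurable (restrict_space borel {z. z \<in> \<real>\<^sub>\<le>\<^sub>0})"
    unfolding Complex_eq by (intro measurable_restrict_space1) measurable
  have meas: "{z \<in> space borel. z \<in> \<real>\<^sub>\<le>\<^sub>0} \<in> sets (borel :: complex measure)"
    by (simp add: borel_closed closed_nonpos_Reals_complex)
  have eq: "(if z \<in> \<real>\<^sub>\<le>\<^sub>0 then (if z = 0 then Ln 0 else Complex (ln (norm z)) pi) else Ln z) = Ln z" for z
  proof (cases "z \<in> \<real>\<^sub>\<le>\<^sub>0 \<and> z \<noteq> 0")
    case True
    then have "Re z < 0 \<and> Im z = 0"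
      by (auto simp: complex_nonpos_Reals_iff complex_eq_iff)
    then have "Ln z = Complex (ln (norm z)) pi"
      using True Im_Ln_eq_pi[of z] by (intro complex_eqI) auto
    then show ?thesis using True by simp
  qed auto
  have "(\<lambda>z. if z \<in> \<real>\<^sub>\<le>\<^sub>0 then (if z = 0 then Ln 0 else Complex (ln (norm z)) pi) else Ln z)
      \<in> borel_measurable borel"
    using 1 2 by (simp only: measurable_If_restrict_space_iff[OF meas])
  then show ?thesis by (simp only: eq)
qed

lemma norm_Ln_diff_of_real_le:
  assumes "z \<noteq> 0"
  shows "norm (Ln z - of_real c) \<le> \<bar>ln (norm z) - c\<bar> + pi"
proof -
  have "norm (Ln z - of_real c) \<le> \<bar>Re (Ln z - of_real c)\<bar> + \<bar>Im (Ln z - of_real c)\<bar>"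
    by (rule cmod_le)
  moreover have "\<bar>Im (Ln z)\<bar> \<le> pi"
    using mpi_less_Im_Ln[OF assms] Im_Ln_le_pi[OF assms] by linarith
  ultimately show ?thesis using assms by simp
qed

text \<open>
  The kernel as a function of the point \<open>\<xi>\<close> of the circle and the point \<open>z\<close> of the closed disk. At
  \<open>z = \<xi>\<close> the argument of \<^const>\<open>Ln\<close> is \<open>1 / 0 = 0\<close>, so the kernel takes a value without significance there.
\<close>

definition log_kernel :: "complex \<Rightarrow> complex \<Rightarrow> complex" where
  "log_kernel \<xi> z = Ln (1 / (1 - cnj \<xi> * z))"

lemma measurable_cnj [measurable]: "cnj \<in> borel_measurable borel"
  by (intro borel_measurable_continuous_onI continuous_intros)

lemma measurable_log_kernel [measurable]:
  assumes [measurable]: "f \<in> borel_measurable M" "g \<in> borel_measurable M"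
  shows "(\<lambda>x. log_kernel (f x) (g x)) \<in> borel_measurable M"
  unfolding log_kernel_def by measurable

lemma cnj_mult_eq_1_iff:
  assumes "norm \<xi> = 1"
  shows "cnj \<xi> * \<eta> = 1 \<longleftrightarrow> \<eta> = \<xi>"
proof
  assume "cnj \<xi> * \<eta> = 1"
  then have "\<xi> * cnj \<xi> * \<eta> = \<xi>" by (simp add: mult.assoc)
  then show "\<eta> = \<xi>" using assms by (simp add: complex_norm_square[symmetric])
next
  assume "\<eta> = \<xi>"
  then show "cnj \<xi> * \<eta> = 1"
    using assms complex_norm_square[of \<xi>] by (simp add: mult.commute)
qed

lemma Re_less_1_of_norm_1:
  assumes "norm \<zeta> = 1" "\<zeta> \<noteq> 1" shows "Re \<zeta> < 1"
proof (rule ccontr)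
  assume "\<not> Re \<zeta> < 1"
  then have "Re \<zeta> = 1" using complex_Re_le_cmod[of \<zeta>] assms by simp
  moreover from this have "Im \<zeta> = 0" using assms by (simp add: cmod_def)
  ultimately show False using assms by (simp add: complex_eq_iff)
qed

text \<open>A majorant of the kernel along the radius to \<open>\<eta>\<close> that does not depend on \<open>r\<close>.\<close>

lemma norm_log_kernel_radial_le:
  assumes "norm \<xi> = 1" "norm \<eta> = 1" "\<eta> \<noteq> \<xi>" "0 \<le> r" "r \<le> 1"
  shows "norm (log_kernel \<xi> (of_real r * \<eta>)) \<le> 5 + log_spike 2 (1 - cnj \<xi> * \<eta>)"
proof -
  define \<zeta> where "\<zeta> = cnj \<xi> * \<eta>"
  have \<zeta>: "norm \<zeta> = 1" "\<zeta> \<noteq> 1"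
    using assms cnj_mult_eq_1_iff[of \<xi> \<eta>] by (auto simp: \<zeta>_def norm_mult)
  define w where "w = 1 - of_real r * \<zeta>"
  have kernel: "log_kernel \<xi> (of_real r * \<eta>) = Ln (1 / w)"
    by (simp add: log_kernel_def w_def \<zeta>_def mult.left_commute)
  have nr: "norm (of_real r * \<zeta>) = r" using \<zeta> assms by (simp add: norm_mult)
  have "norm w \<le> 1 + r"
    unfolding w_def using norm_triangle_ineq4[of 1 "of_real r * \<zeta>"] nr by simp
  then have w2: "norm w \<le> 2" using assms by simp
  have "norm (1 - \<zeta>) \<le> norm w + norm ((of_real r - 1) * \<zeta>)"
    using norm_triangle_ineq[of w "(of_real r - 1) * \<zeta>"] by (simp add: w_def algebra_simps)
  also have "norm ((of_real r - 1) * \<zeta>) = 1 - r"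
    using \<zeta> assms norm_of_real[of "r - 1", where ?'a = complex] by (simp add: norm_mult)
  also have "1 - r \<le> norm w"
    unfolding w_def using norm_triangle_ineq2[of 1 "of_real r * \<zeta>"] nr by simp
  finally have w_ge: "norm (1 - \<zeta>) \<le> 2 * norm w" by simp
  have pos: "0 < norm (1 - \<zeta>)" using \<zeta> by simp
  then have w0: "0 < norm w" using w_ge by linarith
  have "\<bar>ln (norm (1 / w))\<bar> \<le> 1 + log_spike 2 (1 - \<zeta>)"
  proof (cases "norm w \<ge> 1")
    case True
    then have "\<bar>ln (norm (1 / w))\<bar> = ln (norm w)"
      using w0 by (simp add: norm_divide ln_div)
    also have "\<dots> \<le> ln 2" using w0 w2 by simp
    also have "\<dots> \<le> 1" using ln_add_one_self_le_self[of 1] by simp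
    finally show ?thesis using log_spike_nonneg[of 2 "1 - \<zeta>"] by linarith
  next
    case False
    then have "\<bar>ln (norm (1 / w))\<bar> = ln (1 / norm w)"
      using w0 by (simp add: norm_divide ln_div)
    also have "\<dots> \<le> ln (2 / norm (1 - \<zeta>))"
      using w0 w_ge pos by (intro ln_mono) (auto simp: field_simps)
    also have "\<dots> \<le> log_spike 2 (1 - \<zeta>)" by (simp add: log_spike_def)
    finally show ?thesis by simp
  qed
  moreover have "norm (Ln (1 / w)) \<le> \<bar>ln (norm (1 / w))\<bar> + pi"
    using norm_Ln_diff_of_real_le[of "1 / w" 0] w0 by auto
  ultimately show ?thesis
    unfolding kernel \<zeta>_def[symmetric] using pi_less_4 by linarith
qed

text \<open>
  On a set of points within \<open>h\<close> of \<open>\<eta>\<^sub>0\<close>, the kernel differs from a constant by a bounded amount and a spike.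
  With \<open>d\<close> and \<open>d\<^sub>0\<close> the distances of \<open>\<eta>\<close> and \<open>\<eta>\<^sub>0\<close> from \<open>\<xi>\<close>: if \<open>d\<^sub>0\<close> exceeds \<open>2 * h\<close> then \<open>d\<close> and \<open>d\<^sub>0\<close> are
  comparable, and otherwise the comparison is with \<open>ln h\<close>.
\<close>

lemma norm_log_kernel_oscillation_le:
  assumes "norm \<xi> = 1" "\<eta> \<noteq> \<xi>" "norm (\<eta> - \<eta>\<^sub>0) \<le> h" "h > 0"
  shows "norm (log_kernel \<xi> \<eta> - of_real (- ln (max h (norm (1 - cnj \<xi> * \<eta>\<^sub>0)))))
         \<le> 5 + log_spike (2 * h) (1 - cnj \<xi> * \<eta>)"
proof -
  define d d\<^sub>0 where "d = norm (1 - cnj \<xi> * \<eta>)" and "d\<^sub>0 = norm (1 - cnj \<xi> * \<eta>\<^sub>0)"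
  define m where "m = max h d\<^sub>0"
  have "(1 - cnj \<xi> * \<eta>\<^sub>0) - (1 - cnj \<xi> * \<eta>) = cnj \<xi> * (\<eta> - \<eta>\<^sub>0)"
    by (simp add: algebra_simps)
  then have "\<bar>d\<^sub>0 - d\<bar> \<le> h"
    unfolding d_def d\<^sub>0_def using assms norm_triangle_ineq3[of "1 - cnj \<xi> * \<eta>\<^sub>0" "1 - cnj \<xi> * \<eta>"]
    by (simp add: norm_mult)
  then have dd: "d \<le> d\<^sub>0 + h" "d\<^sub>0 \<le> d + h" by linarith+
  have d: "0 < d"
    using assms cnj_mult_eq_1_iff[of \<xi> \<eta>] by (auto simp: d_def)
  have m: "0 < m" using assms by (simp add: m_def)
  have ln2: "ln (2::real) \<le> 1" using ln_add_one_self_le_self[of 1] by simp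
  have "d \<le> 2 * m" using dd by (auto simp: m_def)
  then have "ln d \<le> ln (2 * m)" using d m by simp
  then have upper: "ln d - ln m \<le> 1" using m ln2 by (simp add: ln_mult)
  have lower: "ln m - ln d \<le> 1 + log_spike (2 * h) (1 - cnj \<xi> * \<eta>)"
  proof (cases "d\<^sub>0 \<le> 2 * h")
    case True
    then have "ln m \<le> ln (2 * h)" using m assms by (intro ln_mono) (auto simp: m_def)
    then have "ln m - ln d \<le> ln (2 * h / d)" using d assms by (simp add: ln_div)
    also have "\<dots> \<le> log_spike (2 * h) (1 - cnj \<xi> * \<eta>)" by (simp add: log_spike_def d_def)
    finally show ?thesis by simp
  next
    case False
    then have "m \<le> 2 * d" using dd assms by (auto simp: m_def)
    then have "ln m \<le> ln (2 * d)" using d m by simp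
    then have "ln m - ln d \<le> 1" using d ln2 by (simp add: ln_mult)
    then show ?thesis using log_spike_nonneg[of "2 * h" "1 - cnj \<xi> * \<eta>"] by linarith
  qed
  have "norm (log_kernel \<xi> \<eta> - of_real (- ln m)) \<le> \<bar>ln (norm (1 / (1 - cnj \<xi> * \<eta>))) - (- ln m)\<bar> + pi"
    unfolding log_kernel_def by (rule norm_Ln_diff_of_real_le) (use d in \<open>auto simp: d_def\<close>)
  also have "ln (norm (1 / (1 - cnj \<xi> * \<eta>))) = - ln d"
    using d by (simp add: norm_divide d_def ln_div)
  finally show ?thesis
    unfolding m_def[symmetric] d\<^sub>0_def[symmetric] using upper lower pi_less_4
      log_spike_nonneg[of "2 * h" "1 - cnj \<xi> * \<eta>"] by linarith
qed

lemma tendsto_log_kernel_radial: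
  assumes "norm \<xi> = 1" "norm \<eta> = 1" "\<eta> \<noteq> \<xi>"
  shows "((\<lambda>r. log_kernel \<xi> (of_real r * \<eta>)) \<longlongrightarrow> log_kernel \<xi> \<eta>) (at_left 1)"
proof -
  define \<zeta> where "\<zeta> = cnj \<xi> * \<eta>"
  have \<zeta>: "norm \<zeta> = 1" "\<zeta> \<noteq> 1"
    using assms cnj_mult_eq_1_iff[of \<xi> \<eta>] by (auto simp: \<zeta>_def norm_mult)
  have "0 < Re (1 - \<zeta>)"
    using Re_less_1_of_norm_1[OF \<zeta>] by simp
  then have "0 < Re (1 / (1 - \<zeta>))"
    using \<zeta> by (simp add: Re_divide complex_eq_iff zero_less_divide_iff sum_power2_gt_zero_iff)
  then have nonpos: "1 / (1 - \<zeta>) \<notin> \<real>\<^sub>\<le>\<^sub>0"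
    by (auto simp: complex_nonpos_Reals_iff)
  have "((\<lambda>r. Ln (1 / (1 - cnj \<xi> * (of_real r * \<eta>)))) \<longlongrightarrow> Ln (1 / (1 - cnj \<xi> * (of_real 1 * \<eta>)))) (at_left 1)"
    by (intro tendsto_intros) (use \<zeta> nonpos in \<open>auto simp: \<zeta>_def\<close>)
  then show ?thesis by (simp add: log_kernel_def)
qed

text \<open>A kernel bounded in \<open>L\<^sup>1(M)\<close> uniformly in its first variable maps finite measures to \<open>L\<^sup>1(M)\<close>.\<close>

lemma kernel_potential_integrable:
  fixes k :: "'a \<Rightarrow> 'b \<Rightarrow> complex"
  assumes "finite_measure N" "sigma_finite_measure M"
  assumes k [measurable]: "case_prod k \<in> borel_measurable (N \<Otimes>\<^sub>M M)"
  assumes K: "\<And>x. x \<in> space N \<Longrightarrow> (\<integral>\<^sup>+y. ennreal (norm (k x y)) \<partial>M) \<le> ennreal K" "0 \<le> K"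
  shows "AE y in M. integrable N (\<lambda>x. k x y)"
    and "integrable M (\<lambda>y. \<integral>x. k x y \<partial>N)"
    and "(\<integral>y. norm (\<integral>x. k x y \<partial>N) \<partial>M) \<le> K * measure N (space N)"
proof -
  interpret N: finite_measure N by fact
  interpret M: sigma_finite_measure M by fact
  interpret pair_sigma_finite N M ..
  have "(\<integral>\<^sup>+y. \<integral>\<^sup>+x. ennreal (norm (k x y)) \<partial>N \<partial>M) = (\<integral>\<^sup>+x. \<integral>\<^sup>+y. ennreal (norm (k x y)) \<partial>M \<partial>N)"
    by (rule Fubini') measurable
  also have "\<dots> \<le> (\<integral>\<^sup>+x. ennreal K \<partial>N)"
    by (intro nn_integral_mono K)
  also have "\<dots> = ennreal (K * measure N (space N))"
    using K by (simp add: N.emeasure_eq_measure ennreal_mult)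
  finally have bd: "(\<integral>\<^sup>+y. \<integral>\<^sup>+x. ennreal (norm (k x y)) \<partial>N \<partial>M) \<le> ennreal (K * measure N (space N))" .
  have int: "integrable (N \<Otimes>\<^sub>M M) (case_prod k)"
  proof (rule integrableI_bounded)
    have "(\<integral>\<^sup>+p. ennreal (norm (case_prod k p)) \<partial>(N \<Otimes>\<^sub>M M))
        = (\<integral>\<^sup>+y. \<integral>\<^sup>+x. ennreal (norm (k x y)) \<partial>N \<partial>M)"
      by (subst nn_integral_snd[symmetric]) auto
    also note bd
    finally show "(\<integral>\<^sup>+p. ennreal (norm (case_prod k p)) \<partial>(N \<Otimes>\<^sub>M M)) < \<infinity>"
      by (rule le_less_trans) simp
  qed fact
  show "AE y in M. integrable N (\<lambda>x. k x y)" by (rule AE_integrable_snd[OF int])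
  show int': "integrable M (\<lambda>y. \<integral>x. k x y \<partial>N)" by (rule integrable_snd[OF int])
  have "ennreal (\<integral>y. norm (\<integral>x. k x y \<partial>N) \<partial>M) = (\<integral>\<^sup>+y. ennreal (norm (\<integral>x. k x y \<partial>N)) \<partial>M)"
    using int' by (intro nn_integral_eq_integral[symmetric]) auto
  also have "\<dots> \<le> (\<integral>\<^sup>+y. \<integral>\<^sup>+x. ennreal (norm (k x y)) \<partial>N \<partial>M)"
    using AE_integrable_snd[OF int]
    by (intro nn_integral_mono_AE) (auto elim!: eventually_mono intro: integral_norm_bound_ennreal)
  also note bd
  finally show "(\<integral>y. norm (\<integral>x. k x y \<partial>N) \<partial>M) \<le> K * measure N (space N)"
    using K by (subst (asm) ennreal_le_iff) auto
qed

section \<open>Finiteness of the Jordan parts\<close>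

text \<open>
  A finite signed measure has finite positive variation. If the variation \<open>P\<close> were a measure of infinite
  total mass, splitting off sets repeatedly would give disjoint sets whose charges do not tend to zero.
  No proof that \<open>P\<close> is a measure is needed: if it were not, \<^const>\<open>measure_of\<close> would return the null measure.
\<close>

lemma finite_measure_positive_variation:
  fixes \<nu> :: "'a set \<Rightarrow> real"
  assumes sums: "\<And>A :: nat \<Rightarrow> 'a set. range A \<subseteq> sets S \<Longrightarrow> disjoint_family A \<Longrightarrow>
    (\<lambda>n. \<nu> (A n)) sums \<nu> (\<Union>n. A n)"
  shows "finite_measure (positive_variation S \<nu>)"
proof -
  define P where "P A = (SUP B\<in>{B \<in> sets S. B \<subseteq> A}. ennreal (\<nu> B))" for A
  have pv: "positive_variation S \<nu> = measure_of (space S) (sets S) P"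
    by (simp add: positive_variation_def P_def[abs_def])
  have sub: "sets S \<subseteq> Pow (space S)" by (rule sets.space_closed)
  have em: "emeasure (positive_variation S \<nu>)
      = (\<lambda>B. if B \<in> sets S \<and> measure_space (space S) (sets S) P then P B else 0)"
    unfolding pv emeasure_measure_of_conv sets.sigma_sets_eq ..
  have sp: "space (positive_variation S \<nu>) = space S" and
    se: "sets (positive_variation S \<nu>) = sets S"
    unfolding pv using sub by (simp_all add: space_measure_of_conv sets.sigma_sets_eq)
  have empty: "\<nu> {} = 0"
  proof -
    have "(\<lambda>n::nat. \<nu> {}) sums \<nu> {}"
      using sums[of "\<lambda>_. {}"] by (simp add: disjoint_family_on_def)
    then have "(\<lambda>n::nat. \<nu> {}) \<longlonglongrightarrow> 0" by (intro summable_LIMSEQ_zero) (simp add: sums_iff)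
    then show ?thesis by (simp add: LIMSEQ_const_iff)
  qed
  have diff: "\<nu> (A - B) = \<nu> A - \<nu> B" if "A \<in> sets S" "B \<in> sets S" "B \<subseteq> A" for A B
  proof -
    have "(\<lambda>n. \<nu> (binaryset B (A - B) n)) sums \<nu> (\<Union>n. binaryset B (A - B) n)"
      using that by (intro sums) (auto simp: disjoint_family_on_def binaryset_def)
    then have "(\<lambda>n. \<nu> (binaryset B (A - B) n)) sums \<nu> A"
      using that by (simp add: UN_binaryset_eq Un_absorb1)
    moreover have "(\<lambda>n. \<nu> (binaryset B (A - B) n)) sums (\<nu> B + \<nu> (A - B))"
      by (rule binaryset_sums) (rule empty)
    ultimately show ?thesis using sums_unique2 by fastforce
  qed
  show ?thesis
  proof (cases "measure_space (space S) (sets S) P")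
    case False
    then show ?thesis
      by (intro finite_measureI) (simp add: em)
  next
    case True
    then have emP: "emeasure (positive_variation S \<nu>) A = P A" if "A \<in> sets S" for A
      using that by (simp add: em)
    \<comment> \<open>From a set of infinite positive variation, a set of charge at least one in absolute value
      can be split off so that what remains still has infinite positive variation.\<close>
    have split: "\<exists>A'. A' \<in> sets S \<and> A' \<subseteq> A \<and> P A' = \<infinity> \<and> 1 \<le> \<bar>\<nu> (A - A')\<bar>"
      if A: "A \<in> sets S" "P A = \<infinity>" for A
    proof -
      have "ennreal (\<bar>\<nu> A\<bar> + 1) < P A"
        using A by simp
      then obtain B where B: "B \<in> sets S" "B \<subseteq> A" "ennreal (\<bar>\<nu> A\<bar> + 1) < ennreal (\<nu> B)"
        unfolding P_def by (auto simp: less_SUP_iff)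
      then have "\<bar>\<nu> A\<bar> + 1 < \<nu> B"
        by (subst (asm) ennreal_less_iff) auto
      then have "1 \<le> \<bar>\<nu> B\<bar>" "1 \<le> \<bar>\<nu> (A - B)\<bar>" using diff A B by auto
      moreover have "P A = P B + P (A - B)"
        using A(1) B(1,2) plus_emeasure[of B "positive_variation S \<nu>" "A - B"]
        by (simp add: emP se Un_absorb1)
      moreover have "A - (A - B) = B" using B by auto
      ultimately have "P B = \<infinity> \<and> 1 \<le> \<bar>\<nu> (A - B)\<bar> \<or> P (A - B) = \<infinity> \<and> 1 \<le> \<bar>\<nu> (A - (A - B))\<bar>"
        using A(2) by (metis ennreal_add_eq_top infinity_ennreal_def)
      then show ?thesis
        using A(1) B(1,2) by (meson Diff_subset sets.Diff)
    qed
    have "P (space S) \<noteq> \<infinity>"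
    proof
      assume inf: "P (space S) = \<infinity>"
      have "\<exists>A. \<forall>n::nat. (A n \<in> sets S \<and> P (A n) = \<infinity>) \<and>
          (A (Suc n) \<subseteq> A n \<and> 1 \<le> \<bar>\<nu> (A n - A (Suc n))\<bar>)"
      proof (rule dependent_nat_choice)
        show "\<exists>A. A \<in> sets S \<and> P A = \<infinity>" using inf sets.top by blast
      qed (use split in blast)
      then obtain A where A: "\<And>n::nat. A n \<in> sets S \<and> P (A n) = \<infinity>"
        "\<And>n. A (Suc n) \<subseteq> A n \<and> 1 \<le> \<bar>\<nu> (A n - A (Suc n))\<bar>"
        by blast
      then have "decseq A" by (auto intro: decseq_SucI)
      have "disjoint_family (\<lambda>n. A n - A (Suc n))"
      proof -
        have "(A m - A (Suc m)) \<inter> (A n - A (Suc n)) = {}" if "m < n" for m n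
          using \<open>decseq A\<close> that decseqD[of A "Suc m" n] by auto
        then show ?thesis
          unfolding disjoint_family_on_def by (metis Int_commute linorder_neqE_nat)
      qed
      moreover have "range (\<lambda>n. A n - A (Suc n)) \<subseteq> sets S" using A by auto
      ultimately have "(\<lambda>n. \<nu> (A n - A (Suc n))) sums \<nu> (\<Union>n. A n - A (Suc n))"
        by (intro sums)
      then have "(\<lambda>n. \<nu> (A n - A (Suc n))) \<longlonglongrightarrow> 0"
        by (intro summable_LIMSEQ_zero) (rule sums_summable)
      then have "(\<lambda>n. \<bar>\<nu> (A n - A (Suc n))\<bar>) \<longlonglongrightarrow> 0"
        by (rule tendsto_rabs_zero)
      then have "1 \<le> (0::real)"
        using A by (intro LIMSEQ_le_const[of _ 0 1]) auto
      then show False by simp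
    qed
    then show ?thesis
      by (intro finite_measureI) (simp add: sp emP)
  qed
qed

section \<open>Potentials of positive measures\<close>

text \<open>
  The logarithmic potential of a positive measure, both in the disk and, where the integral converges,
  on the circle.
\<close>

definition log_potential :: "complex measure \<Rightarrow> complex \<Rightarrow> complex" where
  "log_potential N z = (\<integral>\<xi>. log_kernel \<xi> z \<partial>N)"

lemma nn_integral_log_kernel_bound:
  assumes "norm \<xi> = 1" "h > 0" "A \<in> sets circle_borel"
    and g: "\<And>\<eta>. norm \<eta> = 1 \<Longrightarrow> \<eta> \<noteq> \<xi> \<Longrightarrow> norm (g \<eta>) \<le> (5 + log_spike h (1 - cnj \<xi> * \<eta>)) * indicator A \<eta>"
  shows "(\<integral>\<^sup>+\<eta>. ennreal (norm (g \<eta>)) \<partial>circle_lebesgue)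
    \<le> ennreal (5 * measure circle_lebesgue A + 32 * h)"
proof -
  have A [measurable]: "A \<in> sets circle_lebesgue" using assms by simp
  have [measurable]: "(\<lambda>\<eta>. log_spike h (1 - cnj \<xi> * \<eta>)) \<in> borel_measurable circle_lebesgue"
    by (subst measurable_cong_sets[OF sets_circle_lebesgue refl])
      (intro borel_measurable_circle_borel, measurable)
  have "(\<integral>\<^sup>+\<eta>. ennreal (norm (g \<eta>)) \<partial>circle_lebesgue)
      \<le> (\<integral>\<^sup>+\<eta>. 5 * indicator A \<eta> + ennreal (log_spike h (1 - cnj \<xi> * \<eta>)) \<partial>circle_lebesgue)"
  proof (rule nn_integral_mono_AE)
    show "AE \<eta> in circle_lebesgue. ennreal (norm (g \<eta>)) \<le> 5 * indicator A \<eta> + ennreal (log_spike h (1 - cnj \<xi> * \<eta>))"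
      using AE_not_in[OF singleton_null_circle[OF \<open>norm \<xi> = 1\<close>]] AE_space
    proof eventually_elim
      fix \<eta> assume "\<eta> \<notin> {\<xi>}" "\<eta> \<in> space circle_lebesgue"
      then have "norm (g \<eta>) \<le> (5 + log_spike h (1 - cnj \<xi> * \<eta>)) * indicator A \<eta>"
        using g by simp
      also have "\<dots> \<le> 5 * indicator A \<eta> + log_spike h (1 - cnj \<xi> * \<eta>)"
        by (simp split: split_indicator)
      finally have "ennreal (norm (g \<eta>)) \<le> ennreal (5 * indicator A \<eta> + log_spike h (1 - cnj \<xi> * \<eta>))"
        by (rule ennreal_leI)
      also have "\<dots> = 5 * indicator A \<eta> + ennreal (log_spike h (1 - cnj \<xi> * \<eta>))"
        by (simp split: split_indicator)
      finally show "ennreal (norm (g \<eta>)) \<le> \<dots>" .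
    qed
  qed
  also have "\<dots> = 5 * emeasure circle_lebesgue A
      + (\<integral>\<^sup>+\<eta>. ennreal (log_spike h (1 - cnj \<xi> * \<eta>)) \<partial>circle_lebesgue)"
    using assms(3) by (simp add: nn_integral_add nn_integral_cmult_indicator)
  also have "\<dots> \<le> 5 * emeasure circle_lebesgue A + ennreal (32 * h)"
    using assms by (intro add_left_mono nn_integral_log_spike_le)
  also have "\<dots> = ennreal (5 * measure circle_lebesgue A + 32 * h)"
    using \<open>h > 0\<close> by (simp add: circle.emeasure_eq_measure ennreal_mult)
  finally show ?thesis .
qed

lemma measurable_circle_id:
  assumes "sets N = sets circle_borel" "f \<in> borel_measurable borel"
  shows "f \<in> borel_measurable N"
  using assms borel_measurable_circle_borel measurable_cong_sets by blast

lemma measurable_circle_pair: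
  assumes "sets N = sets circle_borel"
  shows "fst \<in> borel_measurable (N \<Otimes>\<^sub>M circle_lebesgue)"
    and "snd \<in> borel_measurable (N \<Otimes>\<^sub>M circle_lebesgue)"
  using measurable_compose[OF measurable_fst measurable_circle_id[OF assms, of "\<lambda>x. x"]]
    measurable_compose[OF measurable_snd measurable_circle_id[OF sets_circle_lebesgue, of "\<lambda>x. x"]]
  by auto

lemma measurable_log_kernel_pair:
  assumes "sets N = sets circle_borel"
  shows "(\<lambda>(\<xi>, \<eta>). log_kernel \<xi> (c * \<eta>)) \<in> borel_measurable (N \<Otimes>\<^sub>M circle_lebesgue)"
proof -
  note [measurable] = measurable_circle_pair[OF assms]
  show ?thesis unfolding case_prod_beta by measurable
qed

lemma
  assumes N: "finite_measure N" "sets N = sets circle_borel" and r: "0 \<le> r" "r \<le> 1"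
  shows integrable_log_potential_radial:
      "integrable circle_lebesgue (\<lambda>\<eta>. log_potential N (of_real r * \<eta>))" (is ?int)
    and integral_norm_log_potential_radial_le:
      "(\<integral>\<eta>. norm (log_potential N (of_real r * \<eta>)) \<partial>circle_lebesgue)
       \<le> (5 * measure circle_lebesgue unit_circle + 64) * measure N unit_circle" (is ?le)
    and AE_integrable_log_kernel_radial:
      "AE \<eta> in circle_lebesgue. integrable N (\<lambda>\<xi>. log_kernel \<xi> (of_real r * \<eta>))" (is ?AE)
proof -
  have sp: "space N = unit_circle" using sets_eq_imp_space_eq[OF N(2)] by simp
  have bd: "(\<integral>\<^sup>+\<eta>. ennreal (norm (log_kernel \<xi> (of_real r * \<eta>))) \<partial>circle_lebesgue)
      \<le> ennreal (5 * measure circle_lebesgue unit_circle + 64)" if "\<xi> \<in> space N" for \<xi>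
    using nn_integral_log_kernel_bound[of \<xi> 2 unit_circle "\<lambda>\<eta>. log_kernel \<xi> (of_real r * \<eta>)"]
      norm_log_kernel_radial_le[of \<xi> _ r] r that closed_subset_circle_borel[of unit_circle]
    by (auto simp: sp)
  note * = kernel_potential_integrable[OF N(1) circle.sigma_finite_measure_axioms
    measurable_log_kernel_pair[OF N(2), of "of_real r"] bd]
  show ?int ?le ?AE
    using * by (auto simp: log_potential_def[abs_def] sp)
qed

text \<open>The restriction of the potential to the circle is its own boundary function.\<close>

lemma has_boundary_values_log_potential:
  assumes N: "finite_measure N" "sets N = sets circle_borel"
  shows "has_boundary_values (log_potential N) (log_potential N)"
proof -
  interpret N: finite_measure N by fact
  interpret pair_sigma_finite N circle_lebesgue ..
  have sp: "space N = unit_circle" using sets_eq_imp_space_eq[OF N(2)] by simp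
  note [measurable] = measurable_circle_pair[OF N(2)]
  \<comment> \<open>For almost every \<open>\<eta>\<close> the majorant is integrable and \<open>\<eta>\<close> is not an atom of \<open>N\<close>.\<close>
  have "AE \<eta> in circle_lebesgue. integrable N (\<lambda>\<xi>. of_real (log_spike 2 (1 - cnj \<xi> * \<eta>)) :: complex)"
  proof (rule kernel_potential_integrable(1)[OF N(1) circle.sigma_finite_measure_axioms])
    show "(\<lambda>(\<xi>, \<eta>). of_real (log_spike 2 (1 - cnj \<xi> * \<eta>)) :: complex) \<in> borel_measurable (N \<Otimes>\<^sub>M circle_lebesgue)"
      unfolding case_prod_beta by measurable
    show "(\<integral>\<^sup>+\<eta>. ennreal (norm (of_real (log_spike 2 (1 - cnj \<xi> * \<eta>)) :: complex)) \<partial>circle_lebesgue) \<le> ennreal 64"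
      if "\<xi> \<in> space N" for \<xi>
      using nn_integral_log_spike_le[of 2 \<xi>] that by (simp add: sp)
  qed simp
  then have dom: "AE \<eta> in circle_lebesgue. integrable N (\<lambda>\<xi>. log_spike 2 (1 - cnj \<xi> * \<eta>))"
    by (simp add: complex_of_real_integrable_eq)
  have "AE \<xi> in N. AE \<eta> in circle_lebesgue. \<eta> \<noteq> \<xi>"
  proof (rule AE_I2)
    fix \<xi> assume "\<xi> \<in> space N"
    then show "AE \<eta> in circle_lebesgue. \<eta> \<noteq> \<xi>"
      using AE_not_in[OF singleton_null_circle[of \<xi>]] by (simp add: sp)
  qed
  then have diag: "AE \<eta> in circle_lebesgue. AE \<xi> in N. \<eta> \<noteq> \<xi>"
    by (subst (asm) AE_commute) measurable
  show ?thesis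
    unfolding has_boundary_values_def using dom diag AE_space
  proof eventually_elim
    fix \<eta>
    assume int: "integrable N (\<lambda>\<xi>. log_spike 2 (1 - cnj \<xi> * \<eta>))"
      and neq: "AE \<xi> in N. \<eta> \<noteq> \<xi>" and "\<eta> \<in> space circle_lebesgue"
    then have \<eta>: "norm \<eta> = 1" by simp
    show "((\<lambda>r. log_potential N (of_real r * \<eta>)) \<longlongrightarrow> log_potential N \<eta>) (at_left 1)"
    proof (rule tendsto_at_left_sequentially[of 0])
      fix S :: "nat \<Rightarrow> real"
      assume S: "\<And>n. S n < 1" "\<And>n. 0 < S n" "S \<longlonglongrightarrow> 1"
      have lim: "filterlim S (at_left 1) sequentially"
        using S by (auto simp: filterlim_at less_imp_neq intro!: always_eventually)
      note [measurable] = measurable_circle_id[OF N(2), of "\<lambda>x. x"]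
      show "(\<lambda>n. log_potential N (of_real (S n) * \<eta>)) \<longlonglongrightarrow> log_potential N \<eta>"
        unfolding log_potential_def
      proof (rule integral_dominated_convergence)
        show "integrable N (\<lambda>\<xi>. 5 + log_spike 2 (1 - cnj \<xi> * \<eta>))"
          using int by simp
        show "AE \<xi> in N. (\<lambda>n. log_kernel \<xi> (of_real (S n) * \<eta>)) \<longlonglongrightarrow> log_kernel \<xi> \<eta>"
          using neq AE_space
        proof eventually_elim
          fix \<xi> assume "\<eta> \<noteq> \<xi>" "\<xi> \<in> space N"
          then show "(\<lambda>n. log_kernel \<xi> (of_real (S n) * \<eta>)) \<longlonglongrightarrow> log_kernel \<xi> \<eta>"
            using filterlim_compose[OF tendsto_log_kernel_radial[of \<xi> \<eta>] lim] \<eta> by (simp add: sp)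
        qed
        show "AE \<xi> in N. norm (log_kernel \<xi> (of_real (S n) * \<eta>)) \<le> 5 + log_spike 2 (1 - cnj \<xi> * \<eta>)" for n
          using neq AE_space
        proof eventually_elim
          fix \<xi> assume "\<eta> \<noteq> \<xi>" "\<xi> \<in> space N"
          then show "norm (log_kernel \<xi> (of_real (S n) * \<eta>)) \<le> 5 + log_spike 2 (1 - cnj \<xi> * \<eta>)"
            using norm_log_kernel_radial_le[of \<xi> \<eta> "S n"] \<eta> S(1,2)[of n] by (simp add: sp)
        qed
      qed measurable
    qed simp
  qed
qed

lemma set_integrable_circle:
  fixes \<phi> :: "complex \<Rightarrow> 'b::{banach, second_countable_topology}"
  assumes "integrable circle_lebesgue \<phi>" "I \<in> sets circle_borel"
  shows "set_integrable circle_lebesgue I \<phi>"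
  unfolding set_integrable_def using assms by (intro integrable_mult_indicator) auto

text \<open>Up to a factor of two, the mean may be replaced by any other constant \<open>c\<close>.\<close>

lemma mean_oscillation_le:
  assumes \<phi>: "integrable circle_lebesgue \<phi>" and I: "I \<in> sets circle_borel" "0 < measure circle_lebesgue I"
    and B: "(LINT \<eta>:I|circle_lebesgue. norm (\<phi> \<eta> - c)) \<le> B * measure circle_lebesgue I"
  shows "mean_oscillation \<phi> I \<le> 2 * B"
proof -
  let ?m = "measure circle_lebesgue I"
  have [measurable]: "I \<in> sets circle_lebesgue" using I by simp
  have I_space: "I \<inter> unit_circle = I"
    using sets.sets_into_space[OF I(1)] by auto
  have int: "set_integrable circle_lebesgue I (\<lambda>\<eta>. \<phi> \<eta> - d)" for d
    using \<phi> I by (intro set_integrable_circle) auto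
  have const: "(LINT \<eta>:I|circle_lebesgue. d) = ?m *\<^sub>R d" for d :: complex
  proof -
    have "integrable circle_lebesgue (indicat_real I)"
      by (intro integrable_real_indicator) (auto simp: I(1) circle.emeasure_eq_measure)
    then show ?thesis
      using I_space by (simp add: set_lebesgue_integral_def)
  qed
  define a where "a = circle_mean \<phi> I"
  have "a - c = (LINT \<eta>:I|circle_lebesgue. \<phi> \<eta> - c) / of_real ?m"
  proof -
    have "(LINT \<eta>:I|circle_lebesgue. \<phi> \<eta> - c)
        = (LINT \<eta>:I|circle_lebesgue. \<phi> \<eta>) - (LINT \<eta>:I|circle_lebesgue. c)"
      using \<phi> I by (intro set_integral_diff set_integrable_circle) auto
    then show ?thesis
      using I by (simp add: a_def circle_mean_def const scaleR_conv_of_real field_simps)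
  qed
  then have "norm (a - c) * ?m = norm (LINT \<eta>:I|circle_lebesgue. \<phi> \<eta> - c)"
    using I by (simp add: norm_divide)
  also have "\<dots> \<le> (LINT \<eta>:I|circle_lebesgue. norm (\<phi> \<eta> - c))"
    by (rule set_integral_norm_bound[OF int])
  also note B
  finally have a: "norm (a - c) * ?m \<le> B * ?m" .
  have "(LINT \<eta>:I|circle_lebesgue. norm (\<phi> \<eta> - a))
      \<le> (LINT \<eta>:I|circle_lebesgue. norm (\<phi> \<eta> - c) + norm (a - c))"
  proof (rule set_integral_mono)
    show "set_integrable circle_lebesgue I (\<lambda>\<eta>. norm (\<phi> \<eta> - a))"
      by (rule set_integrable_norm[OF int])
    show "set_integrable circle_lebesgue I (\<lambda>\<eta>. norm (\<phi> \<eta> - c) + norm (a - c))"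
      using I by (intro set_integral_add set_integrable_norm[OF int] set_integrable_circle) auto
    show "norm (\<phi> \<eta> - a) \<le> norm (\<phi> \<eta> - c) + norm (a - c)" for \<eta>
      using norm_triangle_ineq4[of "\<phi> \<eta> - c" "a - c"] by simp
  qed
  also have "\<dots> = (LINT \<eta>:I|circle_lebesgue. norm (\<phi> \<eta> - c)) + (LINT \<eta>:I|circle_lebesgue. norm (a - c))"
    using I by (intro set_integral_add set_integrable_norm[OF int] set_integrable_circle) auto
  also have "(LINT \<eta>:I|circle_lebesgue. norm (a - c)) = norm (a - c) * ?m"
    using I I_space by (simp add: set_lebesgue_integral_def)
  also have "(LINT \<eta>:I|circle_lebesgue. norm (\<phi> \<eta> - c)) + norm (a - c) * ?m \<le> B * ?m + B * ?m"
    using B a by simp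
  finally show ?thesis
    unfolding mean_oscillation_def a_def[symmetric] using I by (simp add: field_simps)
qed

lemma norm_cis_diff_le: "norm (cis s - cis t) \<le> \<bar>s - t\<bar>"
proof -
  have "cis s - cis t = cis t * (cis (s - t) - 1)"
    by (simp add: algebra_simps cis_mult)
  then have "norm (cis s - cis t) = 2 * \<bar>sin ((s - t) / 2)\<bar>"
    using dist_exp_i_1[of "s - t"] by (simp add: norm_mult cis_conv_exp)
  also have "\<dots> \<le> \<bar>s - t\<bar>"
    using abs_sin_x_le_abs_x[of "(s - t) / 2"] by simp
  finally show ?thesis .
qed

lemma mean_oscillation_log_potential_le:
  assumes N: "finite_measure N" "sets N = sets circle_borel" and I: "I \<in> circle_arcs"
  shows "mean_oscillation (log_potential N) I \<le> 2 * ((5 + 256 * pi) * measure N unit_circle)"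
proof -
  interpret N: finite_measure N by fact
  have sp: "space N = unit_circle" using sets_eq_imp_space_eq[OF N(2)] by simp
  obtain a b where ab: "a < b" "b \<le> a + 2 * pi" "I = cis ` {a..b}"
    using I by (auto simp: circle_arcs_def)
  have I_sets: "I \<in> sets circle_borel" by (rule arc_measurable[OF I])
  then have [measurable]: "I \<in> sets circle_lebesgue" by simp
  let ?m = "measure circle_lebesgue I"
  define h where "h = b - a"
  have h: "0 < h" "h \<le> 4 * pi * ?m"
    using ab measure_arc_ge[of a b] by (auto simp: h_def)
  have m: "0 < ?m" by (rule measure_arc_pos[OF I])
  have chord: "norm (\<eta> - cis a) \<le> h" if \<eta>: "\<eta> \<in> I" for \<eta>
  proof -
    obtain t where "\<eta> = cis t" "a \<le> t" "t \<le> b" using \<eta> ab by auto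
    then show ?thesis using norm_cis_diff_le[of t a] by (simp add: h_def)
  qed
  define c where "c \<xi> = complex_of_real (- ln (max h (norm (1 - cnj \<xi> * cis a))))" for \<xi>
  \<comment> \<open>Integrating this kernel over \<open>\<xi>\<close> gives the potential minus \<open>c\<^sub>0\<close>, cut off to \<open>I\<close>.\<close>
  define k where "k \<xi> \<eta> = indicator I \<eta> *\<^sub>R (log_kernel \<xi> \<eta> - c \<xi>)" for \<xi> \<eta>
  define c\<^sub>0 where "c\<^sub>0 = (\<integral>\<xi>. c \<xi> \<partial>N)"
  have c_meas [measurable]: "c \<in> borel_measurable borel"
    unfolding c_def by measurable
  have c_int: "integrable N c"
  proof (rule N.integrable_const_bound)
    show "AE \<xi> in N. norm (c \<xi>) \<le> \<bar>ln h\<bar> + \<bar>ln (h + 2)\<bar>"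
    proof (rule AE_I2)
      fix \<xi> assume "\<xi> \<in> space N"
      then have "norm (1 - cnj \<xi> * cis a) \<le> 2"
        using norm_triangle_ineq4[of 1 "cnj \<xi> * cis a"] by (simp add: sp norm_mult)
      then have "ln h \<le> ln (max h (norm (1 - cnj \<xi> * cis a)))" "ln (max h (norm (1 - cnj \<xi> * cis a))) \<le> ln (h + 2)"
        using h by (auto intro!: ln_mono)
      then show "norm (c \<xi>) \<le> \<bar>ln h\<bar> + \<bar>ln (h + 2)\<bar>"
        by (auto simp: c_def)
    qed
  qed (rule measurable_circle_id[OF N(2) c_meas])
  have k_meas: "case_prod k \<in> borel_measurable (N \<Otimes>\<^sub>M circle_lebesgue)"
  proof -
    note [measurable] = measurable_circle_pair[OF N(2)]
    show ?thesis unfolding k_def case_prod_beta by measurable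
  qed
  have k_bound: "(\<integral>\<^sup>+\<eta>. ennreal (norm (k \<xi> \<eta>)) \<partial>circle_lebesgue) \<le> ennreal ((5 + 256 * pi) * ?m)"
    if "\<xi> \<in> space N" for \<xi>
  proof -
    have "(\<integral>\<^sup>+\<eta>. ennreal (norm (k \<xi> \<eta>)) \<partial>circle_lebesgue) \<le> ennreal (5 * ?m + 32 * (2 * h))"
    proof (rule nn_integral_log_kernel_bound)
      fix \<eta> assume "norm \<eta> = 1" "\<eta> \<noteq> \<xi>"
      then show "norm (k \<xi> \<eta>) \<le> (5 + log_spike (2 * h) (1 - cnj \<xi> * \<eta>)) * indicator I \<eta>"
        using norm_log_kernel_oscillation_le[of \<xi> \<eta> "cis a" h] chord[of \<eta>] that h
        by (auto simp: k_def c_def sp split: split_indicator)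
    qed (use that h I_sets in \<open>auto simp: sp\<close>)
    also have "\<dots> \<le> ennreal ((5 + 256 * pi) * ?m)"
      using h by (intro ennreal_leI) (simp add: algebra_simps)
    finally show ?thesis .
  qed
  note k = kernel_potential_integrable[OF N(1) circle.sigma_finite_measure_axioms k_meas k_bound]
  have "(LINT \<eta>:I|circle_lebesgue. norm (log_potential N \<eta> - c\<^sub>0))
      = (\<integral>\<eta>. norm (\<integral>\<xi>. k \<xi> \<eta> \<partial>N) \<partial>circle_lebesgue)"
    unfolding set_lebesgue_integral_def
  proof (rule integral_cong_AE)
    show "AE \<eta> in circle_lebesgue. indicat_real I \<eta> *\<^sub>R norm (log_potential N \<eta> - c\<^sub>0) = norm (\<integral>\<xi>. k \<xi> \<eta> \<partial>N)"
      using AE_integrable_log_kernel_radial[OF N, of 1]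
      by (auto elim!: eventually_mono simp: k_def log_potential_def c\<^sub>0_def c_int)
    have "integrable circle_lebesgue (log_potential N)"
      using integrable_log_potential_radial[OF N, of 1] by simp
    then have [measurable]: "log_potential N \<in> borel_measurable circle_lebesgue" by simp
    show "(\<lambda>\<eta>. indicat_real I \<eta> *\<^sub>R norm (log_potential N \<eta> - c\<^sub>0)) \<in> borel_measurable circle_lebesgue"
      by measurable
    show "(\<lambda>\<eta>. norm (\<integral>\<xi>. k \<xi> \<eta> \<partial>N)) \<in> borel_measurable circle_lebesgue"
      using k(2) by simp
  qed
  also have "\<dots> \<le> (5 + 256 * pi) * ?m * measure N (space N)"
    by (rule k(3)) (simp_all add: add_nonneg_nonneg)
  finally have "(LINT \<eta>:I|circle_lebesgue. norm (log_potential N \<eta> - c\<^sub>0))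
      \<le> (5 + 256 * pi) * measure N unit_circle * ?m"
    by (simp add: sp mult.commute mult.left_commute)
  then show ?thesis
    using integrable_log_potential_radial[OF N, of 1] I_sets m
    by (intro mean_oscillation_le) auto
qed

lemma log_potential_in_BMO_circle:
  assumes "finite_measure N" "sets N = sets circle_borel"
  shows "log_potential N \<in> BMO_circle"
  using integrable_log_potential_radial[OF assms, of 1] mean_oscillation_log_potential_le[OF assms]
  by (auto simp: BMO_circle_def)

section \<open>Linear combinations of potentials\<close>

text \<open>
  The functions that are integrable on the circles \<open>norm z = r < 1\<close>, with bounded \<open>L\<^sup>1\<close> means there, and that
  have boundary values in BMO. Unlike \<^const>\<open>BMOA\<close> this asks for no holomorphy, so that it can be checked
  for the four potentials one by one; integrability is part of the condition because closure under
  addition needs it.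
\<close>

definition BMO_boundary :: "(complex \<Rightarrow> complex) set" where
  "BMO_boundary = {g.
     (\<exists>C. \<forall>r\<in>{0..<1}. integrable circle_lebesgue (\<lambda>\<xi>. g (complex_of_real r * \<xi>)) \<and>
        (LINT \<xi>|circle_lebesgue. norm (g (complex_of_real r * \<xi>))) \<le> C) \<and>
     (\<exists>\<phi>\<in>BMO_circle. has_boundary_values g \<phi>)}"

lemma log_potential_in_BMO_boundary:
  assumes "finite_measure N" "sets N = sets circle_borel"
  shows "log_potential N \<in> BMO_boundary"
  unfolding BMO_boundary_def
  using integrable_log_potential_radial[OF assms] integral_norm_log_potential_radial_le[OF assms]
    log_potential_in_BMO_circle[OF assms] has_boundary_values_log_potential[OF assms]
  by (auto intro!: exI[of _ "(5 * measure circle_lebesgue unit_circle + 64) * measure N unit_circle"])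

lemma const_in_BMO_boundary: "(\<lambda>_. c) \<in> BMO_boundary"
proof -
  have "mean_oscillation (\<lambda>_. c) I \<le> 2 * 0" if I: "I \<in> circle_arcs" for I
    using I by (intro mean_oscillation_le[of _ _ c] arc_measurable measure_arc_pos) auto
  then have "(\<lambda>_. c) \<in> BMO_circle"
    by (auto simp: BMO_circle_def)
  moreover have "has_boundary_values (\<lambda>_. c) (\<lambda>_. c)"
    by (simp add: has_boundary_values_def)
  ultimately show ?thesis
    by (auto simp: BMO_boundary_def)
qed

lemma mean_oscillation_add_le:
  assumes \<phi>: "integrable circle_lebesgue \<phi>" and \<psi>: "integrable circle_lebesgue \<psi>"
    and I: "I \<in> sets circle_borel"
  shows "mean_oscillation (\<lambda>\<xi>. \<phi> \<xi> + \<psi> \<xi>) I \<le> mean_oscillation \<phi> I + mean_oscillation \<psi> I"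
proof -
  have mean: "circle_mean (\<lambda>\<xi>. \<phi> \<xi> + \<psi> \<xi>) I = circle_mean \<phi> I + circle_mean \<psi> I"
    using assms by (simp add: circle_mean_def set_integral_add set_integrable_circle add_divide_distrib)
  have int: "set_integrable circle_lebesgue I (\<lambda>\<xi>. norm (u \<xi> - c))"
    if "integrable circle_lebesgue u" for u :: "complex \<Rightarrow> complex" and c
    using that I by (intro set_integrable_norm set_integrable_circle) auto
  have "(LINT \<xi>:I|circle_lebesgue. norm (\<phi> \<xi> + \<psi> \<xi> - (circle_mean \<phi> I + circle_mean \<psi> I)))
      \<le> (LINT \<xi>:I|circle_lebesgue. norm (\<phi> \<xi> - circle_mean \<phi> I) + norm (\<psi> \<xi> - circle_mean \<psi> I))"
  proof (rule set_integral_mono)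
    show "norm (\<phi> \<xi> + \<psi> \<xi> - (circle_mean \<phi> I + circle_mean \<psi> I))
        \<le> norm (\<phi> \<xi> - circle_mean \<phi> I) + norm (\<psi> \<xi> - circle_mean \<psi> I)" for \<xi>
      using norm_triangle_ineq[of "\<phi> \<xi> - circle_mean \<phi> I" "\<psi> \<xi> - circle_mean \<psi> I"]
      by (simp add: algebra_simps)
  qed (use \<phi> \<psi> in \<open>auto intro!: int set_integral_add(1)\<close>)
  also have "\<dots> = (LINT \<xi>:I|circle_lebesgue. norm (\<phi> \<xi> - circle_mean \<phi> I))
      + (LINT \<xi>:I|circle_lebesgue. norm (\<psi> \<xi> - circle_mean \<psi> I))"
    using \<phi> \<psi> by (intro set_integral_add(2) int)
  finally show ?thesis
    unfolding mean_oscillation_def mean add_divide_distrib[symmetric] by (rule divide_right_mono) simp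
qed

lemma mean_oscillation_cmult:
  "mean_oscillation (\<lambda>\<xi>. c * \<phi> \<xi>) I = norm c * mean_oscillation \<phi> I"
proof -
  have "circle_mean (\<lambda>\<xi>. c * \<phi> \<xi>) I = c * circle_mean \<phi> I"
    by (simp add: circle_mean_def)
  then show ?thesis
    by (simp add: mean_oscillation_def norm_mult flip: right_diff_distrib)
qed

lemma add_in_BMO_boundary:
  assumes "f \<in> BMO_boundary" "g \<in> BMO_boundary"
  shows "(\<lambda>z. f z + g z) \<in> BMO_boundary"
proof -
  obtain C \<phi> K where f: "\<And>r. r \<in> {0..<1} \<Longrightarrow> integrable circle_lebesgue (\<lambda>\<xi>. f (complex_of_real r * \<xi>))"
    "\<And>r. r \<in> {0..<1} \<Longrightarrow> (LINT \<xi>|circle_lebesgue. norm (f (complex_of_real r * \<xi>))) \<le> C"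
    and \<phi>: "integrable circle_lebesgue \<phi>" "\<And>I. I \<in> circle_arcs \<Longrightarrow> mean_oscillation \<phi> I \<le> K"
      "has_boundary_values f \<phi>"
    using assms(1) unfolding BMO_boundary_def BMO_circle_def by blast
  obtain D \<psi> L where g: "\<And>r. r \<in> {0..<1} \<Longrightarrow> integrable circle_lebesgue (\<lambda>\<xi>. g (complex_of_real r * \<xi>))"
    "\<And>r. r \<in> {0..<1} \<Longrightarrow> (LINT \<xi>|circle_lebesgue. norm (g (complex_of_real r * \<xi>))) \<le> D"
    and \<psi>: "integrable circle_lebesgue \<psi>" "\<And>I. I \<in> circle_arcs \<Longrightarrow> mean_oscillation \<psi> I \<le> L"
      "has_boundary_values g \<psi>"
    using assms(2) unfolding BMO_boundary_def BMO_circle_def by blast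
  have norm_le: "(LINT \<xi>|circle_lebesgue. norm (f (complex_of_real r * \<xi>) + g (complex_of_real r * \<xi>))) \<le> C + D"
    if r: "r \<in> {0..<1}" for r
  proof -
    have "(LINT \<xi>|circle_lebesgue. norm (f (complex_of_real r * \<xi>) + g (complex_of_real r * \<xi>)))
        \<le> (LINT \<xi>|circle_lebesgue. norm (f (complex_of_real r * \<xi>)) + norm (g (complex_of_real r * \<xi>)))"
      using f(1)[OF r] g(1)[OF r] by (intro integral_mono) (auto intro: norm_triangle_ineq)
    also have "\<dots> \<le> C + D"
      using f[OF r] g[OF r] by simp
    finally show ?thesis .
  qed
  have BMO: "(\<lambda>\<xi>. \<phi> \<xi> + \<psi> \<xi>) \<in> BMO_circle"
  proof -
    have "mean_oscillation (\<lambda>\<xi>. \<phi> \<xi> + \<psi> \<xi>) I \<le> K + L" if "I \<in> circle_arcs" for I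
      using mean_oscillation_add_le[OF \<phi>(1) \<psi>(1) arc_measurable[OF that]] \<phi>(2)[OF that] \<psi>(2)[OF that]
      by linarith
    then show ?thesis
      using \<phi>(1) \<psi>(1) by (auto simp: BMO_circle_def)
  qed
  have bv: "has_boundary_values (\<lambda>z. f z + g z) (\<lambda>\<xi>. \<phi> \<xi> + \<psi> \<xi>)"
    using \<phi>(3) \<psi>(3) unfolding has_boundary_values_def
    by eventually_elim (rule tendsto_add)
  show ?thesis
    unfolding BMO_boundary_def
  proof (intro CollectI conjI exI[of _ "C + D"] ballI)
    fix r :: real assume r: "r \<in> {0..<1}"
    show "integrable circle_lebesgue (\<lambda>\<xi>. f (complex_of_real r * \<xi>) + g (complex_of_real r * \<xi>))"
      using f(1)[OF r] g(1)[OF r] by simp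
    show "(LINT \<xi>|circle_lebesgue. norm (f (complex_of_real r * \<xi>) + g (complex_of_real r * \<xi>))) \<le> C + D"
      by (rule norm_le[OF r])
  qed (use bv BMO in \<open>rule bexI\<close>)
qed

lemma cmult_in_BMO_boundary:
  assumes "f \<in> BMO_boundary"
  shows "(\<lambda>z. c * f z) \<in> BMO_boundary"
proof -
  obtain C \<phi> K where f: "\<And>r. r \<in> {0..<1} \<Longrightarrow> integrable circle_lebesgue (\<lambda>\<xi>. f (complex_of_real r * \<xi>))"
    "\<And>r. r \<in> {0..<1} \<Longrightarrow> (LINT \<xi>|circle_lebesgue. norm (f (complex_of_real r * \<xi>))) \<le> C"
    and \<phi>: "integrable circle_lebesgue \<phi>" "\<And>I. I \<in> circle_arcs \<Longrightarrow> mean_oscillation \<phi> I \<le> K"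
      "has_boundary_values f \<phi>"
    using assms unfolding BMO_boundary_def BMO_circle_def by blast
  have "(LINT \<xi>|circle_lebesgue. norm (c * f (complex_of_real r * \<xi>))) \<le> norm c * C"
    if "r \<in> {0..<1}" for r
    using f(2)[OF that] by (simp add: norm_mult mult_left_mono)
  moreover have "mean_oscillation (\<lambda>\<xi>. c * \<phi> \<xi>) I \<le> norm c * K" if "I \<in> circle_arcs" for I
    using \<phi>(2)[OF that] by (simp add: mean_oscillation_cmult mult_left_mono)
  then have "(\<lambda>\<xi>. c * \<phi> \<xi>) \<in> BMO_circle"
    using \<phi>(1) by (auto simp: BMO_circle_def)
  moreover have "has_boundary_values (\<lambda>z. c * f z) (\<lambda>\<xi>. c * \<phi> \<xi>)"
    using \<phi>(3) unfolding has_boundary_values_def by eventually_elim (rule tendsto_mult_left)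
  ultimately show ?thesis
    using f(1) unfolding BMO_boundary_def by (auto intro!: exI[of _ "norm c * C"])
qed

lemma has_boundary_values_cong_disk:
  assumes eq: "\<And>z. z \<in> unit_disk \<Longrightarrow> f z = g z" and "has_boundary_values g \<phi>"
  shows "has_boundary_values f \<phi>"
  using assms(2) AE_space unfolding has_boundary_values_def
proof eventually_elim
  fix \<xi> assume lim: "((\<lambda>r. g (complex_of_real r * \<xi>)) \<longlongrightarrow> \<phi> \<xi>) (at_left 1)"
    and "\<xi> \<in> space circle_lebesgue"
  then have "norm \<xi> = 1" by simp
  then have "\<forall>\<^sub>F r in at_left (1::real). g (complex_of_real r * \<xi>) = f (complex_of_real r * \<xi>)"
    by (intro eventually_at_leftI[of 0]) (auto simp: eq norm_mult)
  then show "((\<lambda>r. f (complex_of_real r * \<xi>)) \<longlongrightarrow> \<phi> \<xi>) (at_left 1)"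
    by (rule Lim_transform_eventually[OF lim])
qed

lemma BMOA_of_BMO_boundary:
  assumes "f holomorphic_on unit_disk" "g \<in> BMO_boundary" "\<And>z. z \<in> unit_disk \<Longrightarrow> f z = g z"
  shows "f \<in> BMOA"
proof -
  obtain C \<phi> where C: "\<And>r. r \<in> {0..<1} \<Longrightarrow> (LINT \<xi>|circle_lebesgue. norm (g (complex_of_real r * \<xi>))) \<le> C"
    and \<phi>: "\<phi> \<in> BMO_circle" "has_boundary_values g \<phi>"
    using assms(2) unfolding BMO_boundary_def by blast
  have "(LINT \<xi>|circle_lebesgue. norm (f (complex_of_real r * \<xi>)))
      = (LINT \<xi>|circle_lebesgue. norm (g (complex_of_real r * \<xi>)))" if "r \<in> {0..<1}" for r
    using that by (intro Bochner_Integration.integral_cong) (auto simp: assms(3) norm_mult)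
  then have "f \<in> Hardy_1"
    using assms(1) C unfolding Hardy_1_def by auto (metis atLeastLessThan_iff)
  then show ?thesis
    using \<phi> has_boundary_values_cong_disk[of f g \<phi>] assms(3) unfolding BMOA_def by blast
qed

theorem theorem2:
  fixes f :: "complex \<Rightarrow> complex"
  assumes "f \<in> F_0"
  shows "f \<in> BMOA"
proof -
  obtain \<mu> where f: "f holomorphic_on unit_disk" and \<mu>: "complex_measure circle_borel \<mu>"
    and rep: "\<And>z. z \<in> unit_disk \<Longrightarrow>
      f z = f 0 + complex_measure_integral circle_borel \<mu> (\<lambda>\<xi>. Ln (1 / (1 - cnj \<xi> * z)))"
    using assms unfolding F_0_def by blast
  let ?V = "\<lambda>\<nu>. positive_variation circle_borel \<nu>"
  have sets_V: "sets (?V \<nu>) = sets circle_borel" for \<nu>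
    using sets.space_closed[of circle_borel]
    by (simp add: positive_variation_def sets.sigma_sets_eq del: space_circle_borel)
  have sums: "(\<lambda>n. \<mu> (A n)) sums \<mu> (\<Union>n. A n)"
    if "range A \<subseteq> sets circle_borel" "disjoint_family A" for A :: "nat \<Rightarrow> complex set"
    using \<mu> that unfolding complex_measure_def by blast
  have potential: "log_potential (?V \<nu>) \<in> BMO_boundary"
    if "\<nu> = (\<lambda>A. Re (\<mu> A)) \<or> \<nu> = (\<lambda>A. - Re (\<mu> A)) \<or> \<nu> = (\<lambda>A. Im (\<mu> A)) \<or> \<nu> = (\<lambda>A. - Im (\<mu> A))" for \<nu>
  proof (rule log_potential_in_BMO_boundary[OF finite_measure_positive_variation sets_V])
    show "(\<lambda>n. \<nu> (A n)) sums \<nu> (\<Union>n. A n)"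
      if "range A \<subseteq> sets circle_borel" "disjoint_family A" for A :: "nat \<Rightarrow> complex set"
      using \<open>\<nu> = _ \<or> _\<close> sums_Re[OF sums[OF that]] sums_Im[OF sums[OF that]] by (auto intro: sums_minus)
  qed
  define g where "g z = f 0 + (log_potential (?V (\<lambda>A. Re (\<mu> A))) z
      + (-1) * log_potential (?V (\<lambda>A. - Re (\<mu> A))) z
      + \<i> * (log_potential (?V (\<lambda>A. Im (\<mu> A))) z + (-1) * log_potential (?V (\<lambda>A. - Im (\<mu> A))) z))" for z
  have "g \<in> BMO_boundary"
    unfolding g_def
    by (intro add_in_BMO_boundary cmult_in_BMO_boundary const_in_BMO_boundary potential) auto
  moreover have "f z = g z" if "z \<in> unit_disk" for z
    using rep[OF that]
    by (simp add: g_def complex_measure_integral_def log_potential_def log_kernel_def)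
  ultimately show ?thesis
    by (rule BMOA_of_BMO_boundary[OF f])
qed

end
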